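(* Let $s$ be a positive integer and let $(S_n)_{n\ge 0}=\mathsf{LSB}(s)$ be the look-and-say-the-biggest sequence of seed $s$. Then $(S_n)_{n\ge 0}$ is eventually periodic, of period $\tau\le 9$; that is, there exist integers $N\ge 0$ and $1\le\tau\le 9$ such that $S_{n+\tau}=S_n$ for all $n\ge N$.
   Context: Numbers are written in base 10. Run-length representation: a positive integer $T$ has a unique decomposition of its decimal expansion into maximal runs of equal digits, $T=\underbrace{a_1\ldots a_1}_{n_1}\underbrace{a_2\ldots a_2}_{n_2}\ldots\underbrace{a_k\ldots a_k}_{n_k}$, with digits $a_i\in\{0,\dots,9\}$, $n_i\ge 1$, and $a_i\ne a_{i+1}$; we write $\mathsf{RunL}(T)=a_1^{n_1}a_2^{n_2}\cdots a_k^{n_k}=(a_i^{n_i})_i$. Look-and-say-the-biggest sequence: for a seed $S_0\in\mathbb{N}^*$, the sequence $\mathsf{LSB}(S_0)=(S_n)_{n\ge 0}$ is defined recursively as follows: if $(a_i^{n_i})_{1\le i\le k}=\mathsf{RunL}(S_n)$, then $S_{n+1}$ is the integer whose decimal expansion is the concatenation $$\max(n_1,a_1)\,a_1\,\max(n_2,a_2)\,a_2\cdots\max(n_k,a_k)\,a_k,$$ where juxtaposition means concatenation of decimal expansions, each $\max(n_i,a_i)$ being written in base 10 (possibly with several digits). For example, $1\to 11\to 21\to 2211\to 2221\to 3211\to\cdots$. *)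

theory Defs
  imports Main
begin

text \<open>Decimal expansions are lists of digits, most significant digit first.\<close>

fun decimal :: "nat \<Rightarrow> nat list" where
  "decimal n = (if n < 10 then [n] else decimal (n div 10) @ [n mod 10])"

declare decimal.simps [simp del]

lemma decimal_less: "n < 10 \<Longrightarrow> decimal n = [n]"
  and decimal_ge: "\<not> n < 10 \<Longrightarrow> decimal n = decimal (n div 10) @ [n mod 10]"
  by (simp_all add: decimal.simps [of n])

definition of_decimal :: "nat list \<Rightarrow> nat" where
  "of_decimal ds = horner_sum id 10 (rev ds)"

lemma of_decimal_decimal: "of_decimal (decimal n) = n"
proof (induction n rule: decimal.induct)
  case (1 n)
  show ?case
  proof (cases "n < 10")
    case True
    then show ?thesis by (simp add: decimal.simps [of n] of_decimal_def)
  next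
    case False
    with 1 have "of_decimal (decimal (n div 10)) = n div 10" by simp
    with False show ?thesis by (simp add: decimal.simps [of n] of_decimal_def)
  qed
qed

lemma decimal_digits: "d \<in> set (decimal n) \<Longrightarrow> d < 10"
proof (induction n rule: decimal.induct)
  case (1 n)
  then show ?case by (cases "n < 10") (auto simp: decimal.simps [of n])
qed

lemma hd_decimal: "decimal n \<noteq> [] \<and> (0 < n \<longrightarrow> hd (decimal n) \<noteq> 0)"
proof (induction n rule: decimal.induct)
  case (1 n)
  then show ?case by (cases "n < 10") (simp_all add: decimal.simps [of n])
qed

text \<open>A pair \<open>(a, n)\<close> stands for the run \<open>a\<^sup>n\<close>.\<close>

function runs :: "'a list \<Rightarrow> ('a \<times> nat) list" where
  "runs [] = []"
| "runs (x # xs) =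
     (x, Suc (length (takeWhile (\<lambda>y. y = x) xs))) # runs (dropWhile (\<lambda>y. y = x) xs)"
  by pat_completeness auto
termination
  by (relation "measure length") (simp_all add: length_dropWhile_le less_Suc_eq_le)

definition RunL :: "nat \<Rightarrow> (nat \<times> nat) list" where
  "RunL T = runs (decimal T)"

definition is_run_decomposition :: "('a \<times> nat) list \<Rightarrow> 'a list \<Rightarrow> bool" where
  "is_run_decomposition rs xs \<longleftrightarrow>
     concat (map (\<lambda>(a, n). replicate n a) rs) = xs \<and>
     (\<forall>(a, n) \<in> set rs. 1 \<le> n) \<and>
     distinct_adj (map fst rs)"

lemma is_run_decomposition_Cons:
  "is_run_decomposition ((a, n) # rs) xs \<longleftrightarrow>
     (\<exists>ys. xs = replicate n a @ ys \<and> is_run_decomposition rs ys \<and> 1 \<le> n \<and>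
       (rs \<noteq> [] \<longrightarrow> fst (hd rs) \<noteq> a))"
  by (cases rs) (auto simp: is_run_decomposition_def)

lemma hd_run_decomposition:
  assumes "is_run_decomposition rs xs"
  shows "(rs = [] \<longleftrightarrow> xs = []) \<and> (rs \<noteq> [] \<longrightarrow> hd xs = fst (hd rs))"
proof (cases rs)
  case Nil
  with assms show ?thesis by (simp add: is_run_decomposition_def)
next
  case (Cons r rs')
  obtain a n where "r = (a, n)" by (cases r)
  with assms Cons show ?thesis
    by (cases n) (auto simp: is_run_decomposition_Cons)
qed

theorem runs_unique: "is_run_decomposition rs xs \<longleftrightarrow> rs = runs xs"
proof -
  have ex: "is_run_decomposition (runs xs) xs" for xs :: "'a list"
  proof (induction xs rule: runs.induct)
    case 1
    show ?case by (simp add: is_run_decomposition_def)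
  next
    case (2 x xs)
    let ?t = "takeWhile (\<lambda>y. y = x) xs" and ?d = "dropWhile (\<lambda>y. y = x) xs"
    have "?t = replicate (length ?t) x"
      by (rule replicate_length_same [symmetric]) (auto dest: set_takeWhileD)
    then have "x # xs = replicate (Suc (length ?t)) x @ ?d"
      using takeWhile_dropWhile_id [of "\<lambda>y. y = x" xs] by simp
    moreover have "runs ?d \<noteq> [] \<longrightarrow> fst (hd (runs ?d)) \<noteq> x"
      using hd_run_decomposition [OF 2] hd_dropWhile [of "\<lambda>y. y = x" xs] by auto
    ultimately show ?case
      unfolding runs.simps is_run_decomposition_Cons using 2 by (intro exI [of _ ?d]) simp
  qed
  have "rs = runs xs" if "is_run_decomposition rs xs"
    using that
  proof (induction rs arbitrary: xs)
    case Nil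
    then show ?case by (simp add: is_run_decomposition_def)
  next
    case (Cons r rs)
    obtain a n where r: "r = (a, n)" by (cases r)
    with Cons.prems obtain ys where ys: "xs = replicate n a @ ys" "is_run_decomposition rs ys"
      "1 \<le> n" "rs \<noteq> [] \<longrightarrow> fst (hd rs) \<noteq> a"
      by (auto simp: is_run_decomposition_Cons)
    then obtain m where m: "n = Suc m" by (cases n) auto
    have "ys = [] \<or> hd ys \<noteq> a"
      using hd_run_decomposition [OF ys(2)] ys(4) by auto
    then have "takeWhile (\<lambda>y. y = a) ys = []" "dropWhile (\<lambda>y. y = a) ys = ys"
      by (cases ys; simp)+
    then have "runs xs = (a, n) # runs ys"
      by (simp add: ys(1) m takeWhile_append dropWhile_append)
    with Cons.IH [OF ys(2)] r show ?case by simp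
  qed
  with ex show ?thesis by auto
qed

definition LSB_step :: "nat \<Rightarrow> nat" where
  "LSB_step T =
     of_decimal (concat (map (\<lambda>(a, n). decimal (max n a) @ decimal a) (RunL T)))"

primrec LSB :: "nat \<Rightarrow> nat \<Rightarrow> nat" where
  "LSB s 0 = s"
| "LSB s (Suc n) = LSB_step (LSB s n)"

lemma
  "LSB_step 1 = 11" "LSB_step 11 = 21" "LSB_step 21 = 2211"
  "LSB_step 2211 = 2221" "LSB_step 2221 = 3211"
  by (simp_all add: LSB_step_def RunL_def decimal_less decimal_ge of_decimal_def)

end

theory Submission
  imports Defs
begin

text \<open>
  The period is in fact always a divisor of 2. All the work is done on digit words: \<open>say\<close> is
  the step \<open>a\<^sup>n \<mapsto> max(n, a) a\<close> applied to each run, and \<open>decimal_LSB\<close> identifies its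
  orbit with the decimal expansions of the sequence.

  Runs become short. In an image \<open>m\<^sub>1 a\<^sub>1 m\<^sub>2 a\<^sub>2 \<dots>\<close> neighbouring \<open>a\<^sub>i\<close> differ, so a run meets at most
  one \<open>a\<^sub>i\<close> together with the expansions \<open>m\<^sub>i\<close> and \<open>m\<^bsub>i+1\<^esub>\<close> around it. If these have at most
  \<open>L\<close> digits, the run has length at most \<open>2 L + 1\<close>. Iterating, all runs eventually have length at
  most 9, and one step later at most 3, for ever (\<open>eventually_runs_le_3\<close>).

  Short runs make the word fall apart. The last digit of a word never changes. If runs have
  length at most 3, the first digit \<open>y\<close> becomes \<open>max(n, y)\<close> with \<open>n \<le> 3\<close>: it never decreases, and
  it never turns into another digit above 3. So the two sides of a boundary between the digits
  \<open>x\<close> and \<open>y\<close> evolve independently for ever if \<open>x < y\<close>, or if \<open>x \<ge> 4\<close> and \<open>x \<noteq> y\<close>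
  (\<open>funpow_say_append\<close>). Cutting at all these boundaries leaves single runs \<open>a\<^sup>n\<close> with
  \<open>a \<ge> 4\<close>, which become \<open>a a\<close> and stay so, and words \<open>3\<^sup>i 2\<^sup>j 1\<^sup>k 0\<^sup>l\<close> with \<open>i, j, k, l \<le> 3\<close>.
  Each of the latter 256 words enters a cycle of length at most 2 within 6 steps, by
  computation (\<open>settled_low_blocks\<close>); hence so does every word with short runs.
\<close>

section \<open>The step on words\<close>

definition say :: "nat list \<Rightarrow> nat list" where
  "say w = concat (map (\<lambda>(a, n). decimal (max n a) @ [a]) (runs w))"

definition digits :: "nat list \<Rightarrow> bool" where
  "digits w \<longleftrightarrow> (\<forall>d \<in> set w. d < 10)"

definition lead :: "'a \<Rightarrow> 'a list \<Rightarrow> nat" where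
  "lead d w = length (takeWhile (\<lambda>y. y = d) w)"

lemma say_Nil [simp]: "say [] = []"
  by (simp add: say_def)

lemma say_Cons:
  "say (x # xs) =
     decimal (max (Suc (lead x xs)) x) @ x # say (dropWhile (\<lambda>y. y = x) xs)"
  by (simp add: say_def lead_def)

lemma say_eq_Nil_iff [simp]: "say w = [] \<longleftrightarrow> w = []"
  by (cases w) (simp_all add: say_Cons)

lemma funpow_say_eq_Nil_iff [simp]: "(say ^^ k) w = [] \<longleftrightarrow> w = []"
  by (induction k) simp_all

lemma digits_dropWhile: "digits w \<Longrightarrow> digits (dropWhile P w)"
  by (auto simp: digits_def dest: set_dropWhileD)

lemma digits_append [simp]: "digits (u @ v) \<longleftrightarrow> digits u \<and> digits v"
  by (auto simp: digits_def)

lemma digits_Cons [simp]: "digits (d # v) \<longleftrightarrow> d < 10 \<and> digits v"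
  by (simp add: digits_def)

lemma digits_decimal: "digits (decimal n)"
  by (auto simp: digits_def dest: decimal_digits)

lemma digits_say: "digits w \<Longrightarrow> digits (say w)"
proof (induction w rule: runs.induct)
  case 1
  then show ?case by simp
next
  case (2 x xs)
  then show ?case by (simp add: say_Cons digits_decimal digits_dropWhile)
qed

lemma digits_funpow_say: "digits w \<Longrightarrow> digits ((say ^^ k) w)"
  by (induction k) (simp_all add: digits_say)

lemma hd_say_pos: "w \<noteq> [] \<Longrightarrow> hd (say w) \<noteq> 0"
  using hd_decimal by (cases w) (auto simp: say_Cons)

lemma of_decimal_snoc: "of_decimal (w @ [d]) = d + 10 * of_decimal w"
  by (simp add: of_decimal_def)

lemma of_decimal_pos: "w \<noteq> [] \<Longrightarrow> hd w \<noteq> 0 \<Longrightarrow> 0 < of_decimal w"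
proof (induction w rule: rev_induct)
  case Nil
  then show ?case by simp
next
  case (snoc d w)
  then show ?case by (cases "w = []") (simp_all add: of_decimal_snoc of_decimal_def)
qed

text \<open>The nonzero first digit is what makes \<open>say\<close> faithful to the arithmetic step: by
  \<open>hd_say_pos\<close> no leading zero is ever lost when an image is read as a number.\<close>

lemma decimal_of_decimal:
  "w \<noteq> [] \<Longrightarrow> hd w \<noteq> 0 \<Longrightarrow> digits w \<Longrightarrow> decimal (of_decimal w) = w"
proof (induction w rule: rev_induct)
  case Nil
  then show ?case by simp
next
  case (snoc d w)
  show ?case
  proof (cases "w = []")
    case True
    with snoc.prems show ?thesis by (simp add: of_decimal_def decimal_less)
  next
    case False
    with snoc have "0 < of_decimal w" "decimal (of_decimal w) = w" "d < 10"
      using of_decimal_pos by auto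
    then show ?thesis by (simp add: of_decimal_snoc decimal_ge)
  qed
qed

lemma LSB_step_eq: "LSB_step T = of_decimal (say (decimal T))"
proof -
  have "a < 10" if "(a, n) \<in> set (runs (decimal T))" for a n
  proof -
    have *: "is_run_decomposition (runs (decimal T)) (decimal T)"
      by (simp add: runs_unique)
    then have "1 \<le> n" using that by (auto simp: is_run_decomposition_def)
    have "set (replicate n a) \<subseteq> set (decimal T)"
      using * that by (force simp: is_run_decomposition_def dest!: arg_cong [where f = set])
    with \<open>1 \<le> n\<close> show ?thesis by (auto intro: decimal_digits)
  qed
  then have "map (\<lambda>(a, n). decimal (max n a) @ decimal a) (runs (decimal T)) =
      map (\<lambda>(a, n). decimal (max n a) @ [a]) (runs (decimal T))"
    by (auto simp: decimal_less)
  then show ?thesis by (simp only: LSB_step_def RunL_def say_def)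
qed

lemma decimal_LSB:
  assumes "s > 0"
  shows "decimal (LSB s n) = (say ^^ n) (decimal s)"
proof (induction n)
  case 0
  show ?case by simp
next
  case (Suc n)
  let ?w = "(say ^^ n) (decimal s)"
  have "?w \<noteq> []" "digits ?w"
    using hd_decimal [of s] by (simp_all add: digits_funpow_say digits_decimal)
  then have "decimal (of_decimal (say ?w)) = say ?w"
    by (intro decimal_of_decimal) (simp_all add: hd_say_pos digits_say)
  with Suc show ?case by (simp add: LSB_step_eq)
qed

section \<open>Run lengths shrink to three\<close>

text \<open>
  A bound on all runs, phrased through every suffix, since the estimates below prepend
  letters one at a time and follow only the run at the front.
\<close>

fun runs_le :: "nat \<Rightarrow> 'a list \<Rightarrow> bool" where
  "runs_le r [] = True"
| "runs_le r (x # xs) \<longleftrightarrow> Suc (lead x xs) \<le> r \<and> runs_le r xs"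

lemma lead_le_length: "lead d w \<le> length w"
  by (simp add: lead_def length_takeWhile_le)

lemma lead_append_le: "lead d (u @ w) \<le> length u + lead d w"
  by (induction u) (simp_all add: lead_def)

lemma runs_le_length: "runs_le (length w) w"
proof -
  have "length w \<le> r \<Longrightarrow> runs_le r w" for r
  proof (induction w)
    case (Cons x w)
    then show ?case using lead_le_length [of x w] by simp
  qed simp
  then show ?thesis by simp
qed

lemma runs_le_appendD: "runs_le r (u @ w) \<Longrightarrow> runs_le r w"
  by (induction u) simp_all

lemma runs_le_dropWhile: "runs_le r w \<Longrightarrow> runs_le r (dropWhile P w)"
  by (metis runs_le_appendD takeWhile_dropWhile_id)

lemma runs_le_append:
  assumes "runs_le r w" "\<And>d. length u + lead d w \<le> r"
  shows "runs_le r (u @ w)"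
  using assms(2)
proof (induction u)
  case Nil
  then show ?case using assms(1) by simp
next
  case (Cons x u)
  have "Suc (lead x (u @ w)) \<le> r"
    using lead_append_le [of x u w] Cons.prems [of x] by simp
  moreover have "runs_le r (u @ w)"
    using Cons.prems by (intro Cons.IH) (simp add: Suc_le_eq less_imp_le)
  ultimately show ?case by simp
qed

text \<open>The bound on leading runs strengthens the induction. Let \<open>w = x\<^sup>n v\<close>, with image
  \<open>D x (say v)\<close>, where \<open>D\<close> has at most \<open>L\<close> digits. Since \<open>x\<close> is not the first digit of \<open>v\<close>,
  the induction hypothesis leaves at most \<open>L\<close> further copies of \<open>x\<close> in front of \<open>say v\<close>, and
  prepending \<open>D\<close> cannot produce a run longer than \<open>L + 1 + L\<close>. A leading run of a digit other
  than \<open>x\<close> is confined to \<open>D\<close>. The hypothesis \<open>9 \<le> R\<close> lets \<open>R\<close> bound the digits as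
  well as the run lengths.\<close>

lemma runs_le_say_aux:
  assumes "\<And>m. m \<le> R \<Longrightarrow> length (decimal m) \<le> L" "9 \<le> R"
  shows "digits w \<Longrightarrow> runs_le R w \<Longrightarrow>
    runs_le (2 * L + 1) (say w) \<and> (\<forall>d. (w \<noteq> [] \<longrightarrow> d \<noteq> hd w) \<longrightarrow> lead d (say w) \<le> L)"
proof (induction w rule: runs.induct)
  case 1
  then show ?case by (simp add: lead_def)
next
  case (2 x xs)
  let ?v = "dropWhile (\<lambda>y. y = x) xs"
  let ?D = "decimal (max (Suc (lead x xs)) x)"
  have D: "length ?D \<le> L"
    using 2 assms by auto
  have v: "runs_le (2 * L + 1) (say ?v)"
      "\<And>d. (?v \<noteq> [] \<longrightarrow> d \<noteq> hd ?v) \<Longrightarrow> lead d (say ?v) \<le> L"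
    using 2 by (simp_all add: digits_dropWhile runs_le_dropWhile)
  have "?v \<noteq> [] \<longrightarrow> x \<noteq> hd ?v"
    using hd_dropWhile [of "\<lambda>y. y = x" xs] by metis
  then have x: "lead x (say ?v) \<le> L" by (rule v(2))
  have lead: "lead d (x # say ?v) \<le> Suc L" for d
    using x by (cases "x = d") (auto simp: lead_def)
  have "runs_le (2 * L + 1) (?D @ x # say ?v)"
  proof (rule runs_le_append)
    show "runs_le (2 * L + 1) (x # say ?v)" using v(1) x by simp
    show "length ?D + lead d (x # say ?v) \<le> 2 * L + 1" for d
      using D lead [of d] by simp
  qed
  moreover have "lead d (?D @ x # say ?v) \<le> L" if "d \<noteq> x" for d
    using lead_append_le [of d ?D "x # say ?v"] that D by (simp add: lead_def)
  ultimately show ?case by (simp add: say_Cons)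
qed

lemma runs_le_say:
  assumes "\<And>m. m \<le> R \<Longrightarrow> length (decimal m) \<le> L" "9 \<le> R" "digits w" "runs_le R w"
  shows "runs_le (2 * L + 1) (say w)"
  using runs_le_say_aux [of R L w] assms by blast

lemma runs_le_mono: "runs_le r w \<Longrightarrow> r \<le> r' \<Longrightarrow> runs_le r' w"
  by (induction w) auto

lemma runs_le_3_say: "digits w \<Longrightarrow> runs_le 9 w \<Longrightarrow> runs_le 3 (say w)"
  using runs_le_say [of 9 1 w] by (simp add: decimal_less)

text \<open>A crude linear bound, enough for \<open>2 L + 1 < R\<close> as soon as \<open>R \<ge> 10\<close>.\<close>

lemma length_decimal_le: "length (decimal n) \<le> n div 10 + 1"
proof (induction n rule: decimal.induct)
  case (1 n)
  show ?case
  proof (cases "n < 10")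
    case True
    then show ?thesis by (simp add: decimal_less)
  next
    case False
    with 1 have "length (decimal n) \<le> n div 10 div 10 + 2"
      by (simp add: decimal_ge)
    with False show ?thesis by linarith
  qed
qed

lemma eventually_runs_le_3: "digits w \<Longrightarrow> runs_le r w \<Longrightarrow> \<exists>k. runs_le 3 ((say ^^ k) w)"
proof (induction r arbitrary: w rule: less_induct)
  case (less r)
  show ?case
  proof (cases "r \<le> 9")
    case True
    with less.prems have "runs_le 3 ((say ^^ 1) w)"
      by (simp add: runs_le_3_say runs_le_mono)
    then show ?thesis ..
  next
    case False
    let ?r = "2 * (r div 10 + 1) + 1"
    have "?r < r" using False by presburger
    moreover have "runs_le ?r (say w)"
    proof (rule runs_le_say)
      show "length (decimal m) \<le> r div 10 + 1" if "m \<le> r" for m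
        using length_decimal_le [of m] div_le_mono [OF that, of 10] by linarith
    qed (use False less.prems in auto)
    ultimately obtain k where "runs_le 3 ((say ^^ k) (say w))"
      using less digits_say by blast
    then have "runs_le 3 ((say ^^ Suc k) w)"
      by (simp add: funpow_swap1)
    then show ?thesis ..
  qed
qed

section \<open>Boundaries that separate a word for ever\<close>

lemma last_dropWhile_eq:
  "dropWhile (\<lambda>y. y = x) xs \<noteq> [] \<Longrightarrow> last (dropWhile (\<lambda>y. y = x) xs) = last (x # xs)"
  by (induction xs) auto

lemma last_eq_if_dropWhile_Nil:
  "dropWhile (\<lambda>y. y = x) xs = [] \<Longrightarrow> last (x # xs) = x"
  by (induction xs) (auto split: if_splits)

lemma runs_append:
  assumes "u \<noteq> []" "v \<noteq> []" "last u \<noteq> hd v"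
  shows "runs (u @ v) = runs u @ runs v"
  using assms
proof (induction u rule: runs.induct)
  case 1
  then show ?case by simp
next
  case (2 x xs)
  show ?case
  proof (cases "dropWhile (\<lambda>y. y = x) xs = []")
    case True
    then have "\<forall>y \<in> set xs. y = x" by simp
    moreover have "hd v \<noteq> x"
      using 2 last_eq_if_dropWhile_Nil [OF True] by simp
    ultimately show ?thesis
      using True \<open>v \<noteq> []\<close>
      by (cases v) (simp_all add: True takeWhile_append2 dropWhile_append2 takeWhile_eq_all_conv [THEN iffD2]
          del: dropWhile_eq_Nil_conv)
  next
    case False
    then have "\<exists>y \<in> set xs. y \<noteq> x" by simp
    then show ?thesis
      using 2 False by (auto simp: last_dropWhile_eq)
  qed
qed

lemma say_append:
  assumes "u \<noteq> []" "v \<noteq> []" "last u \<noteq> hd v"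
  shows "say (u @ v) = say u @ say v"
  by (simp add: say_def runs_append [OF assms])

lemma last_say: "u \<noteq> [] \<Longrightarrow> last (say u) = last u"
proof (induction u rule: runs.induct)
  case 1
  then show ?case by simp
next
  case (2 x xs)
  show ?case
  proof (cases "dropWhile (\<lambda>y. y = x) xs = []")
    case True
    then have "last (say (x # xs)) = x" by (simp add: say_Cons del: dropWhile_eq_Nil_conv)
    also have "\<dots> = last (x # xs)" by (rule last_eq_if_dropWhile_Nil [OF True, symmetric])
    finally show ?thesis .
  next
    case False
    then have "last (say (x # xs)) = last (say (dropWhile (\<lambda>y. y = x) xs))"
      by (simp add: say_Cons del: dropWhile_eq_Nil_conv)
    also have "\<dots> = last (x # xs)"
      using 2(1) [OF False] last_dropWhile_eq [OF False] by (rule trans)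
    finally show ?thesis .
  qed
qed

lemma hd_say:
  assumes "w \<noteq> []" "digits w" "runs_le 3 w"
  shows "\<exists>n \<le> 3. hd (say w) = max n (hd w)"
proof -
  obtain x xs where w: "w = x # xs" using \<open>w \<noteq> []\<close> by (cases w) auto
  with assms have "Suc (lead x xs) \<le> 3" "x < 10" by simp_all
  with w show ?thesis
    by (intro exI [of _ "Suc (lead x xs)"]) (simp add: say_Cons decimal_less)
qed

text \<open>The last digit \<open>x\<close> of a left part and the first digit \<open>y\<close> of a right part that never merge:
  while \<open>x\<close> is constant, \<open>y\<close> passes to \<open>max n y\<close> with \<open>n \<le> 3\<close>, and the relation is stable under
  this change. A descent from \<open>x \<le> 3\<close> is no barrier, as \<open>y\<close> may grow to \<open>x\<close>.\<close>

definition barrier :: "nat \<Rightarrow> nat \<Rightarrow> bool" where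
  "barrier x y \<longleftrightarrow> x < y \<or> (4 \<le> x \<and> x \<noteq> y)"

text \<open>The barrier survives each step by \<open>last_say\<close> and \<open>hd_say\<close>, so that the runs of both parts
  stay apart and \<open>say_append\<close> applies again.\<close>

lemma funpow_say_append:
  assumes "u \<noteq> []" "v \<noteq> []" "barrier (last u) (hd v)" "digits v" "runs_le 3 v"
  shows "(say ^^ k) (u @ v) = (say ^^ k) u @ (say ^^ k) v"
  using assms
proof (induction k arbitrary: u v)
  case 0
  show ?case by simp
next
  case (Suc k)
  obtain n where "n \<le> 3" "hd (say v) = max n (hd v)"
    using hd_say Suc.prems by blast
  then have "barrier (last (say u)) (hd (say v))"
    using Suc.prems by (auto simp: last_say barrier_def max_def)
  then have "(say ^^ k) (say u @ say v) = (say ^^ k) (say u) @ (say ^^ k) (say v)"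
    using Suc.prems by (intro Suc.IH)
      (simp_all add: digits_say runs_le_3_say runs_le_mono [of 3 _ 9])
  moreover have "say (u @ v) = say u @ say v"
    using Suc.prems by (intro say_append) (auto simp: barrier_def)
  ultimately show ?case by (simp add: funpow_swap1)
qed

section \<open>Blocks between the boundaries\<close>

lemma say_replicate_append:
  assumes "0 < n" "v \<noteq> [] \<Longrightarrow> hd v \<noteq> a"
  shows "say (replicate n a @ v) = decimal (max n a) @ a # say v"
proof -
  obtain m where "n = Suc m" using \<open>0 < n\<close> by (cases n) auto
  moreover have "lead a (replicate m a @ v) = m" "dropWhile (\<lambda>y. y = a) (replicate m a @ v) = v" for m
    using assms(2) by (induction m; cases v; simp add: lead_def)+
  ultimately show ?thesis by (simp add: say_Cons)
qed

text \<open>A one-pass form of \<open>say\<close>, where \<open>n\<close> counts the letters \<open>a\<close> already read from the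
  current run. As code equations for \<open>say\<close> it makes rewriting of concrete words fast.\<close>

fun say_from :: "nat \<Rightarrow> nat \<Rightarrow> nat list \<Rightarrow> nat list" where
  "say_from a n [] = decimal (max n a) @ [a]"
| "say_from a n (b # w) =
     (if b = a then say_from a (Suc n) w else decimal (max n a) @ a # say_from b 1 w)"

lemma say_from_eq: "0 < n \<Longrightarrow> say_from a n w = say (replicate n a @ w)"
proof (induction a n w rule: say_from.induct)
  case (1 a n)
  then show ?case using say_replicate_append [of n "[]" a] by simp
next
  case (2 a n b w)
  then show ?case
    using say_replicate_append [of n "b # w" a] by (auto simp: replicate_app_Cons_same)
qed

lemma say_code [code]:
  "say [] = []"
  "say (a # w) = say_from a 1 w"
  by (simp_all add: say_from_eq)

definition low_block :: "nat \<Rightarrow> nat \<Rightarrow> nat \<Rightarrow> nat \<Rightarrow> nat list" where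
  "low_block i j k l = replicate i 3 @ replicate j 2 @ replicate k 1 @ replicate l 0"

definition settled :: "nat list \<Rightarrow> bool" where
  "settled w \<longleftrightarrow> say (say w) = w"

text \<open>The steps are needed for digits to be created to the left. A 0 puts a 1 before it, a run of
  1s of length 2 puts a 2 before it, and a run of 2s of length 3 puts a 3 before it; once these
  insertions merge with runs already present, only run lengths still alternate. The slowest
  words, such as \<open>333222111000\<close>, take exactly 6 steps.\<close>

lemma settled_low_blocks:
  "\<forall>i \<in> set [0, 1, 2, 3]. \<forall>j \<in> set [0, 1, 2, 3]. \<forall>k \<in> set [0, 1, 2, 3]. \<forall>l \<in> set [0, 1, 2, 3].
     settled ((say ^^ 6) (low_block i j k l))"
  by code_simp

lemma settled_low_block:
  assumes "i \<le> 3" "j \<le> 3" "k \<le> 3" "l \<le> 3"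
  shows "settled ((say ^^ 6) (low_block i j k l))"
proof -
  have "n \<in> set [0, 1, 2, 3]" if "n \<le> 3" for n :: nat
    using that by auto
  with assms settled_low_blocks show ?thesis by blast
qed

lemma settled_high_block:
  assumes "4 \<le> a" "a < 10" "0 < n" "n \<le> 3"
  shows "settled ((say ^^ 6) (replicate n a))"
proof -
  have say: "say (replicate m a) = replicate 2 a" if "0 < m" "m \<le> 3" for m
    using say_replicate_append [of m "[]" a] that assms
    by (simp add: decimal_less max_def numeral_2_eq_2)
  \<comment> \<open>the length 2 is reached after one step, whatever \<open>n\<close> is\<close>
  have "(say ^^ Suc k) (replicate n a) = replicate 2 a" for k
    by (induction k) (use say assms in simp_all)
  from this [of 5] show ?thesis by (simp add: settled_def say)
qed

lemma split_leading_run: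
  assumes "runs_le r w"
  obtains n v where "w = replicate n a @ v" "n \<le> r" "v \<noteq> [] \<Longrightarrow> hd v \<noteq> a" "runs_le r v"
proof
  let ?P = "\<lambda>y. y = a"
  show "w = replicate (lead a w) a @ dropWhile ?P w"
    by (induction w) (simp_all add: lead_def)
  show "lead a w \<le> r"
    using assms by (cases w) (auto simp: lead_def)
  show "hd (dropWhile ?P w) \<noteq> a" if "dropWhile ?P w \<noteq> []"
    using hd_dropWhile [OF that] .
  show "runs_le r (dropWhile ?P w)"
    using assms by (rule runs_le_dropWhile)
qed

text \<open>The block is the first run if its digit is at least 4. Otherwise the greedy prefix
  \<open>3\<^sup>i 2\<^sup>j 1\<^sup>k 0\<^sup>l\<close> is nonempty, and what follows starts with a digit above its last one: any
  other digit would have been taken into the prefix.\<close>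

lemma split_settled_block:
  assumes "w \<noteq> []" "digits w" "runs_le 3 w"
  obtains u v where "w = u @ v" "u \<noteq> []" "settled ((say ^^ 6) u)"
    "v \<noteq> [] \<Longrightarrow> barrier (last u) (hd v)"
proof (cases "4 \<le> hd w")
  case True
  obtain n v where w: "w = replicate n (hd w) @ v" "n \<le> 3" "v \<noteq> [] \<Longrightarrow> hd v \<noteq> hd w"
    using split_leading_run [OF \<open>runs_le 3 w\<close>] by metis
  have "0 < n"
    using w(1,3) \<open>w \<noteq> []\<close> by (cases n) auto
  show thesis
  proof (rule that)
    show "w = replicate n (hd w) @ v" by (rule w(1))
    show "replicate n (hd w) \<noteq> []" using \<open>0 < n\<close> by simp
    have "hd w < 10" using assms by (cases w) simp_all
    then show "settled ((say ^^ 6) (replicate n (hd w)))"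
      using settled_high_block True \<open>0 < n\<close> w(2) by blast
    show "barrier (last (replicate n (hd w))) (hd v)" if "v \<noteq> []"
      using w(3) [OF that] True \<open>0 < n\<close> by (auto simp: barrier_def)
  qed
next
  case False
  obtain i w1 where 1: "w = replicate i 3 @ w1" "i \<le> 3" "w1 \<noteq> [] \<Longrightarrow> hd w1 \<noteq> 3" "runs_le 3 w1"
    using split_leading_run [OF \<open>runs_le 3 w\<close>] by metis
  obtain j w2 where 2: "w1 = replicate j 2 @ w2" "j \<le> 3" "w2 \<noteq> [] \<Longrightarrow> hd w2 \<noteq> 2" "runs_le 3 w2"
    using split_leading_run [OF 1(4)] by metis
  obtain k w3 where 3: "w2 = replicate k 1 @ w3" "k \<le> 3" "w3 \<noteq> [] \<Longrightarrow> hd w3 \<noteq> 1" "runs_le 3 w3"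
    using split_leading_run [OF 2(4)] by metis
  obtain l v where 4: "w3 = replicate l 0 @ v" "l \<le> 3" "v \<noteq> [] \<Longrightarrow> hd v \<noteq> 0" "runs_le 3 v"
    using split_leading_run [OF 3(4)] by metis
  show thesis
  proof (rule that)
    show "w = low_block i j k l @ v"
      by (simp add: low_block_def 1(1) 2(1) 3(1) 4(1))
    show "settled ((say ^^ 6) (low_block i j k l))"
      using 1(2) 2(2) 3(2) 4(2) by (rule settled_low_block)
    have nonzero: "\<not> (i = 0 \<and> j = 0 \<and> k = 0 \<and> l = 0)"
    proof
      assume "i = 0 \<and> j = 0 \<and> k = 0 \<and> l = 0"
      then have "hd w \<notin> {0, 1, 2, 3}"
        using 1 2 3 4 \<open>w \<noteq> []\<close> by auto
      with False show False by auto
    qed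
    then show "low_block i j k l \<noteq> []" by (auto simp: low_block_def)
    show "barrier (last (low_block i j k l)) (hd v)" if "v \<noteq> []"
    proof -
      consider "0 < l" | "l = 0" "0 < k" | "l = 0" "k = 0" "0 < j" | "l = 0" "k = 0" "j = 0" "0 < i"
        using nonzero by auto
      then show ?thesis
        using 1(1,3) 2(1,3) 3(1,3) 4(1,3) that
        by cases (auto simp: low_block_def barrier_def)
    qed
  qed
qed

lemma settled_append:
  assumes "u \<noteq> []" "v \<noteq> []" "barrier (last u) (hd v)" "digits v" "runs_le 3 v"
    and "settled ((say ^^ k) u)" "settled ((say ^^ k) v)"
  shows "settled ((say ^^ k) (u @ v))"
proof -
  have "settled ((say ^^ k) w) \<longleftrightarrow> (say ^^ Suc (Suc k)) w = (say ^^ k) w" for w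
    by (simp add: settled_def)
  moreover from this have "(say ^^ Suc (Suc k)) (u @ v) = (say ^^ k) (u @ v)"
    using assms(6,7) by (simp only: funpow_say_append [OF assms(1-5)])
  ultimately show ?thesis by blast
qed

lemma settled_funpow_6_say:
  "digits w \<Longrightarrow> runs_le 3 w \<Longrightarrow> settled ((say ^^ 6) w)"
proof (induction w rule: length_induct)
  case (1 w)
  show ?case
  proof (cases "w = []")
    case True
    then have "(say ^^ 6) w = []" by simp
    then show ?thesis by (simp only: settled_def say_Nil)
  next
    case False
    then obtain u v where uv: "w = u @ v" "u \<noteq> []" "settled ((say ^^ 6) u)"
      "v \<noteq> [] \<Longrightarrow> barrier (last u) (hd v)"
      using split_settled_block "1.prems" by metis
    have "digits v" "runs_le 3 v"
      using "1.prems" uv(1) runs_le_appendD by auto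
    moreover from this have "settled ((say ^^ 6) v)"
      using "1.IH" uv(1,2) by simp
    ultimately show ?thesis
      using uv settled_append by (cases "v = []") simp_all
  qed
qed

section \<open>Eventual periodicity\<close>

theorem theorem1:
  fixes s :: nat
  assumes "s > 0"
  shows "\<exists>N \<tau>. 1 \<le> \<tau> \<and> \<tau> \<le> 9 \<and> (\<forall>n\<ge>N. LSB s (n + \<tau>) = LSB s n)"
proof -
  let ?W = "\<lambda>n. (say ^^ n) (decimal s)"
  obtain k where "runs_le 3 (?W k)"
    using eventually_runs_le_3 [OF digits_decimal runs_le_length] by blast
  moreover have "digits (?W k)"
    by (simp add: digits_funpow_say digits_decimal)
  ultimately have "settled ((say ^^ 6) (?W k))"
    by (rule settled_funpow_6_say [rotated])
  then have start: "?W (6 + k + 2) = ?W (6 + k)"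
    by (simp only: settled_def funpow_add o_apply add.commute [of _ 2]) (simp add: numeral_2_eq_2)
  have "?W (n + 2) = ?W n" if "n \<ge> 6 + k" for n
    using that
  proof (induction n rule: dec_induct)
    case base
    show ?case by (rule start)
  next
    case (step n)
    then show ?case by simp
  qed
  then have "LSB s (n + 2) = LSB s n" if "n \<ge> 6 + k" for n
    using that of_decimal_decimal by (metis decimal_LSB [OF assms])
  then show ?thesis
    by (intro exI [of _ "6 + k"] exI [of _ 2]) simp
qed

end
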